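(* Let $\mathbb{A}$ be a set of possible actions, $K$ a positive integer (the horizon length), and $f:\mathbb{A}^*\to\mathbb{R}$ an objective function. Consider the problem of maximizing $f(M)$ subject to $M\in\mathbb{A}^*$, $|M|\le K$. Let $O_K=(o_1,\ldots,o_K)$ be an optimal strategy of length $K$ and $G_K=(g_1,\ldots,g_K)$ a greedy strategy. If $f$ is $K$-submodular and $K$-GO-concave, then $$f(G_K)\ \ge\ \left(1-\left(1-\frac1K\right)^K\right)f(O_K)\ >\ (1-e^{-1})f(O_K).$$
   Context: $\mathbb{A}^*$ denotes the set of all finite strings $(a_1,\ldots,a_k)$ of elements of $\mathbb{A}$ of arbitrary length, including the empty string $\varnothing$; $|M|$ is the length of the string $M$; $M\oplus N$ is the concatenation of $M$ followed by $N$; $M\preceq N$ means $N=M\oplus L$ for some $L\in\mathbb{A}^*$ ($M$ is a prefix of $N$). An optimal strategy is any solution of the problem of maximizing $f(M)$ over $M\in\mathbb{A}^*$ with $|M|\le K$; $O_K=(o_1,\ldots,o_K)$ denotes an optimal strategy of length $K$. A greedy strategy is a string $G_K=(g_1,\ldots,g_K)$ such that for every $i=1,\ldots,K$, $g_i\in\operatorname{argmax}_{g\in\mathbb{A}} f((g_1,\ldots,g_{i-1},g))$. Write $G_i=(g_1,\ldots,g_i)$ and $\bar O_{K-i}=(o_{i+1},\ldots,o_K)$. $f$ is $K$-monotone if $f(M\oplus N)\ge f(M)$ for all $M,N\in\mathbb{A}^*$ with $|M|+|N|\le K$. $f$ is $K$-diminishing if $f(M\oplus(a))-f(M)\ge f(N\oplus(a))-f(N)$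 for all $M\preceq N$ in $\mathbb{A}^*$ with $|N|\le K-1$ and all $a\in\mathbb{A}$. $f$ is $K$-submodular if it is both $K$-monotone and $K$-diminishing. $f$ is $K$-GO-concave if for all $1\le i\le K-1$, $$f(G_i\oplus\bar O_{K-i})\ \ge\ \frac iK f(G_i)+\left(1-\frac iK\right)f(O_K).$$
   Formalization: The formal theorem assumes f(∅) ≥ 0 (otherwise f ≡ −1 with K = 2 is a counterexample) and claims the strict inequality only when f(O_K) > 0 (for f ≡ 0 it would read 0 > 0). *)

theory Defs
  imports Complex_Main "HOL-Library.Sublist"
begin

text \<open>
  The set of finite strings over the action set \<open>A\<close> is \<open>lists A\<close>; an objective function on it
  is represented by a function on all lists, of which only the values on \<open>lists A\<close> matter.
  The entry \<open>o\<^sub>i\<close> (counted from 1) of a string is \<open>xs ! (i - 1)\<close>, so the initial part of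
  length \<open>i\<close> is \<open>take i xs\<close> and the remaining part is \<open>drop i xs\<close>.
\<close>

definition optimal_strategy :: "'a set \<Rightarrow> nat \<Rightarrow> ('a list \<Rightarrow> real) \<Rightarrow> 'a list \<Rightarrow> bool" where
  "optimal_strategy A K f M \<longleftrightarrow> is_arg_max f (\<lambda>N. N \<in> lists A \<and> length N \<le> K) M"

definition greedy_strategy :: "'a set \<Rightarrow> nat \<Rightarrow> ('a list \<Rightarrow> real) \<Rightarrow> 'a list \<Rightarrow> bool" where
  "greedy_strategy A K f G \<longleftrightarrow> length G = K \<and>
     (\<forall>i<K. is_arg_max (\<lambda>g. f (take i G @ [g])) (\<lambda>g. g \<in> A) (G ! i))"

definition K_monotone :: "'a set \<Rightarrow> nat \<Rightarrow> ('a list \<Rightarrow> real) \<Rightarrow> bool" where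
  "K_monotone A K f \<longleftrightarrow>
     (\<forall>M\<in>lists A. \<forall>N\<in>lists A. length M + length N \<le> K \<longrightarrow> f (M @ N) \<ge> f M)"

definition K_diminishing :: "'a set \<Rightarrow> nat \<Rightarrow> ('a list \<Rightarrow> real) \<Rightarrow> bool" where
  "K_diminishing A K f \<longleftrightarrow>
     (\<forall>M\<in>lists A. \<forall>N\<in>lists A. \<forall>a\<in>A. prefix M N \<and> length N < K \<longrightarrow>
        f (M @ [a]) - f M \<ge> f (N @ [a]) - f N)"

definition K_submodular :: "'a set \<Rightarrow> nat \<Rightarrow> ('a list \<Rightarrow> real) \<Rightarrow> bool" where
  "K_submodular A K f \<longleftrightarrow> K_monotone A K f \<and> K_diminishing A K f"

text \<open>This property refers to a given greedy strategy \<open>G\<close> and a given optimal strategy \<open>Opt\<close>.\<close>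

definition K_GO_concave ::
  "nat \<Rightarrow> ('a list \<Rightarrow> real) \<Rightarrow> 'a list \<Rightarrow> 'a list \<Rightarrow> bool" where
  "K_GO_concave K f G Opt \<longleftrightarrow>
     (\<forall>i\<in>{1..K - 1}. f (take i G @ drop i Opt) \<ge>
        real i / real K * f (take i G) + (1 - real i / real K) * f Opt)"

end

theory Submission
  imports Defs
begin

text \<open>
  The gap \<open>f Opt - f (take i G)\<close> between the optimum and the greedy value shrinks by a factor
  \<open>1 - 1/K\<close> in every greedy step; after \<open>K\<close> steps, and since \<open>f [] \<ge> 0\<close>, at most the fraction
  \<open>(1 - 1/K) ^ K\<close> of \<open>f Opt\<close> is missing.

  The contraction comes from estimating twice what is gained by completing the greedy string
  \<open>G\<^sub>i\<close> with the last \<open>K - i\<close> actions of the optimal strategy. By diminishing returns, each of these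
  actions adds at most what it would add directly after \<open>G\<^sub>i\<close>, which in turn is at most
  the greedy increment; so the gain is at most \<open>K - i\<close> greedy increments
  (\<open>gain_le_length_times_bound\<close>). By GO-concavity, the gain is at least the fraction \<open>(K - i)/K\<close>
  of the current gap. Cancelling \<open>K - i\<close> shows that a greedy increment covers at least the
  \<open>K\<close>-th part of the gap (\<open>greedy_step_covers_gap\<close>).

  The comparison with \<open>1 - exp (- 1)\<close> is the strict inequality \<open>1 - x < exp (- x)\<close>
  at \<open>x = 1/K\<close>, raised to the power \<open>K\<close>.
\<close>

lemma greedy_strategy_take_in_lists:
  assumes "greedy_strategy A K f G"
  shows "take i G \<in> lists A"
proof -
  have "set G \<subseteq> A"
    using assms by (auto simp: greedy_strategy_def is_arg_max_def in_set_conv_nth)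
  then show ?thesis
    using set_take_subset[of i G] by auto
qed

lemma greedy_strategy_step_best:
  assumes "greedy_strategy A K f G" and "i < K" and "a \<in> A"
  shows "f (take i G @ [a]) \<le> f (take (Suc i) G)"
  using assms
  by (auto simp: greedy_strategy_def is_arg_max_def take_Suc_conv_app_nth not_less)

text \<open>
  Appending \<open>N\<close> one action at a time telescopes the gain, and diminishing returns move every
  action back to the position directly after \<open>M\<close>, where its marginal gain is bounded.
\<close>

lemma gain_le_length_times_bound:
  assumes dim: "K_diminishing A K f" and M: "M \<in> lists A"
    and bound: "\<And>a. a \<in> A \<Longrightarrow> f (M @ [a]) - f M \<le> c"
    and "N \<in> lists A" and "length M + length N \<le> K"
  shows "f (M @ N) - f M \<le> real (length N) * c"
  using assms(4,5)
proof (induction N rule: rev_induct)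
  case Nil
  then show ?case by simp
next
  case (snoc a N)
  have "M @ N \<in> lists A" "a \<in> A" "length (M @ N) < K" "prefix M (M @ N)"
    using M snoc.prems by auto
  then have "f ((M @ N) @ [a]) - f (M @ N) \<le> f (M @ [a]) - f M"
    using dim M unfolding K_diminishing_def by blast
  also have "\<dots> \<le> c"
    using bound snoc.prems by simp
  finally show ?case
    using snoc by (simp add: algebra_simps)
qed

lemma greedy_step_covers_gap:
  assumes Opt: "Opt \<in> lists A" "length Opt = K"
    and greedy: "greedy_strategy A K f G"
    and dim: "K_diminishing A K f"
    and conc: "K_GO_concave K f G Opt"
    and i: "i < K"
  shows "(f Opt - f (take i G)) / real K \<le> f (take (Suc i) G) - f (take i G)"
proof -
  let ?M = "take i G" and ?N = "drop i Opt"
  let ?d = "f (take (Suc i) G) - f ?M"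
  have lens: "length ?M = i" "length ?N = K - i"
    using greedy Opt i by (auto simp: greedy_strategy_def)
  have "?N \<in> lists A"
    using Opt set_drop_subset[of i Opt] by auto
  then have "f (?M @ ?N) - f ?M \<le> real (length ?N) * ?d"
    using dim greedy_strategy_take_in_lists[OF greedy] greedy_strategy_step_best[OF greedy i]
      lens i
    by (intro gain_le_length_times_bound) auto
  moreover have "(1 - real i / real K) * (f Opt - f ?M) \<le> f (?M @ ?N) - f ?M"
  proof (cases "i = 0")
    \<comment> \<open>The concavity condition starts at \<open>i = 1\<close>; for \<open>i = 0\<close> both sides agree.\<close>
    case True
    then show ?thesis by simp
  next
    case False
    then have "i \<in> {1..K - 1}"
      using i by auto
    then show ?thesis
      using conc unfolding K_GO_concave_def by (fastforce simp: algebra_simps)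
  qed
  moreover have "1 - real i / real K = (real K - real i) / real K"
    using i by (simp add: field_simps)
  ultimately have "(real K - real i) * ((f Opt - f ?M) / real K) \<le> (real K - real i) * ?d"
    using lens i by (simp add: of_nat_diff)
  then show ?thesis
    using i by (subst (asm) mult_le_cancel_left_pos) auto
qed

lemma greedy_gap_contracts:
  assumes "Opt \<in> lists A" "length Opt = K"
    and "greedy_strategy A K f G"
    and "K_diminishing A K f"
    and "K_GO_concave K f G Opt"
    and "i \<le> K"
  shows "f Opt - f (take i G) \<le> (1 - 1 / real K) ^ i * (f Opt - f [])"
  using \<open>i \<le> K\<close>
proof (induction i)
  case 0
  then show ?case by simp
next
  case (Suc i)
  have "f Opt - f (take (Suc i) G) \<le> (1 - 1 / real K) * (f Opt - f (take i G))"
    using greedy_step_covers_gap[OF assms(1-5), of i] Suc.prems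
    by (simp add: algebra_simps diff_divide_distrib)
  also have "\<dots> \<le> (1 - 1 / real K) * ((1 - 1 / real K) ^ i * (f Opt - f []))"
    using Suc by (intro mult_left_mono) auto
  finally show ?case by simp
qed

lemma one_minus_inverse_power_less_exp:
  assumes "K > 0"
  shows "(1 - 1 / real K) ^ K < exp (- 1)"
proof -
  have "1 - 1 / real K < exp (- (1 / real K))"
    using exp_minus_greater[of "1 / real K"] assms by simp
  then have "(1 - 1 / real K) ^ K < exp (- (1 / real K)) ^ K"
    using assms by (intro power_strict_mono) auto
  also have "\<dots> = exp (- 1)"
    using assms by (simp flip: exp_of_nat_mult)
  finally show ?thesis .
qed

theorem theorem3:
  fixes A :: "'a set" and K :: nat and f :: "'a list \<Rightarrow> real" and Opt G :: "'a list"
  assumes "K > 0"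
    and "f [] \<ge> 0"
    and "optimal_strategy A K f Opt" and "length Opt = K"
    and "greedy_strategy A K f G"
    and "K_submodular A K f"
    and "K_GO_concave K f G Opt"
  shows "f G \<ge> (1 - (1 - 1 / real K) ^ K) * f Opt \<and>
    (f Opt > 0 \<longrightarrow> (1 - (1 - 1 / real K) ^ K) * f Opt > (1 - exp (- 1)) * f Opt)"
proof (intro conjI impI)
  have "Opt \<in> lists A"
    using assms(3) by (simp add: optimal_strategy_def is_arg_max_def)
  then have "f Opt - f (take K G) \<le> (1 - 1 / real K) ^ K * (f Opt - f [])"
    using assms by (intro greedy_gap_contracts) (auto simp: K_submodular_def)
  also have "\<dots> \<le> (1 - 1 / real K) ^ K * f Opt"
    using assms(1,2) by (intro mult_left_mono) auto
  finally show "f G \<ge> (1 - (1 - 1 / real K) ^ K) * f Opt"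
    using assms(5) by (simp add: greedy_strategy_def algebra_simps)
next
  assume "f Opt > 0"
  then show "(1 - (1 - 1 / real K) ^ K) * f Opt > (1 - exp (- 1)) * f Opt"
    using one_minus_inverse_power_less_exp[OF assms(1)] by simp
qed

end
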